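(* Consider one step of size $h$ from $U^n$ of the two-stage method with stage residuals $$\mathcal R_*(V)=V-U^n-\tfrac h2F(U^n)-\tfrac{h^2}{8}\dot F(U^n)-\tfrac h2G(V)+\tfrac{h^2}{8}\dot G(V),$$ $$\mathcal R_1(W;V)=W-U^n-hF(U^n)-\tfrac{h^2}{6}\big[\dot F(U^n)+2\dot F(V)\big]-hG(W)+\tfrac{h^2}{6}\big[\dot G(W)+2\dot G(V)\big].$$ Let $U^*,U^{n+1}$ be the exact roots of the two implicit stage equations, $\mathcal R_*(U^* )=0$ and $\mathcal R_1(U^{n+1};U^* )=0$, and let $\widehat U^*,\widehat U^{n+1}$ be inexact stage solutions with true residuals $$r_*=\mathcal R_*(\widehat U^* ),\qquad r_1=\mathcal R_1(\widehat U^{n+1};\widehat U^* ).$$ Assume that the local inverse stage Jacobians are uniformly bounded, that the derivative maps $\dot F,\dot G$ are locally Lipschitz, and that the inexact one-step map is stable on the solution neighborhood. Then the one-step perturbation due to the inexact solves satisfies $$\|\widehat U^{n+1}-U^{n+1}\|\le C\big(h^2\|r_*\|+\|r_1\|\big).$$ Consequently, if at every step $\|r_*\|=O(h^3)$ and $\|r_1\|=O(h^5)$, the inexact solves do not change the fourth-order global accuracy of the method. More generally, residual orders $\|r_*\|=O(h^{p_*})$ and $\|r_1\|=O(h^{p_1})$ contribute global errors $O(h^{p_*+1})$ and $O(h^{p_1-1})$, respectively.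
   Context: The method is a time discretization of $U_t=F(U)+G(U)$, with full-field derivatives $\dot F=F_U(F+G)$, $\dot G=G_U(F+G)$; with exact stage solves it is fourth-order accurate globally on a fixed time interval $[0,T]$. "Uniformly bounded local inverse stage Jacobians" is understood in the sense that on the stage neighborhood, which contains the exact and inexact stage states, $\|V-W\|\le C\|\mathcal R_*(V)-\mathcal R_*(W)\|$ and $\|V-W\|\le C\|\mathcal R_1(V;X)-\mathcal R_1(W;X)\|$ for small $h$, with $C$ independent of $h$. Stability of the inexact one-step map $\widehat\Phi_h$ means $\|\widehat\Phi_h(V)-\widehat\Phi_h(W)\|\le(1+Ch)\|V-W\|$ on the solution neighborhood. The global contribution is the error accumulated after $n\le T/h$ steps from the local perturbations; the residual bounds hold uniformly over steps starting in the solution neighborhood. *)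

theory Defs
  imports "HOL-Analysis.Analysis"
begin

text \<open>
  The phase space is an arbitrary real normed space, and \<open>F\<close>, \<open>G\<close> are the two parts of the vector
  field of \<open>U\<^sub>t = F(U) + G(U)\<close>.  With \<open>H\<close> being either part, \<open>full_deriv F G H\<close> is the derivative of
  \<open>H\<close> along the full field, i.e. \<open>H\<^sub>U (F + G)\<close>.
\<close>

definition full_deriv ::
  "('a::real_normed_vector \<Rightarrow> 'a) \<Rightarrow> ('a \<Rightarrow> 'a) \<Rightarrow> ('a \<Rightarrow> 'a) \<Rightarrow> 'a \<Rightarrow> 'a" where
  "full_deriv F G H U = frechet_derivative H (at U) (F U + G U)"

text \<open>In both residuals, \<open>U\<close> is the state at the beginning of the step.\<close>

definition res_star ::
  "('a::real_normed_vector \<Rightarrow> 'a) \<Rightarrow> ('a \<Rightarrow> 'a) \<Rightarrow> real \<Rightarrow> 'a \<Rightarrow> 'a \<Rightarrow> 'a" where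
  "res_star F G h U V =
     V - U - (h / 2) *\<^sub>R F U - (h\<^sup>2 / 8) *\<^sub>R full_deriv F G F U
       - (h / 2) *\<^sub>R G V + (h\<^sup>2 / 8) *\<^sub>R full_deriv F G G V"

text \<open>\<open>res_one F G h U W V\<close> is the residual of \<open>W\<close>, given the intermediate stage \<open>V\<close>.\<close>

definition res_one ::
  "('a::real_normed_vector \<Rightarrow> 'a) \<Rightarrow> ('a \<Rightarrow> 'a) \<Rightarrow> real \<Rightarrow> 'a \<Rightarrow> 'a \<Rightarrow> 'a \<Rightarrow> 'a" where
  "res_one F G h U W V =
     W - U - h *\<^sub>R F U
       - (h\<^sup>2 / 6) *\<^sub>R (full_deriv F G F U + 2 *\<^sub>R full_deriv F G F V)
       - h *\<^sub>R G W
       + (h\<^sup>2 / 6) *\<^sub>R (full_deriv F G G W + 2 *\<^sub>R full_deriv F G G V)"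

text \<open>
  In what follows \<open>N\<close> is the solution neighborhood (states at the beginning of a step) and \<open>D\<close> the
  stage neighborhood.  All bounds hold for all sufficiently small \<open>h > 0\<close>, with constants
  independent of \<open>h\<close>.
\<close>

definition bounded_inverse_stage_jacobians ::
  "('a::real_normed_vector \<Rightarrow> 'a) \<Rightarrow> ('a \<Rightarrow> 'a) \<Rightarrow> 'a set \<Rightarrow> 'a set \<Rightarrow> bool" where
  "bounded_inverse_stage_jacobians F G N D \<longleftrightarrow>
     (\<exists>C. \<forall>\<^sub>F h in at_right 0. \<forall>U\<in>N. \<forall>V\<in>D. \<forall>W\<in>D.
        norm (V - W) \<le> C * norm (res_star F G h U V - res_star F G h U W) \<and>
        (\<forall>X\<in>D. norm (V - W) \<le> C * norm (res_one F G h U V X - res_one F G h U W X)))"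

definition stable_on :: "'a::real_normed_vector set \<Rightarrow> (real \<Rightarrow> 'a \<Rightarrow> 'a) \<Rightarrow> bool" where
  "stable_on N \<Phi> \<longleftrightarrow>
     (\<exists>C. \<forall>\<^sub>F h in at_right 0. \<forall>V\<in>N. \<forall>W\<in>N.
        norm (\<Phi> h V - \<Phi> h W) \<le> (1 + C * h) * norm (V - W))"

text \<open>
  Global accuracy of order \<open>p\<close> on \<open>[0, T]\<close> of the one-step map \<open>\<Phi>\<close>, started from the exact
  initial value.
\<close>

definition globally_accurate ::
  "(real \<Rightarrow> 'a::real_normed_vector) \<Rightarrow> real \<Rightarrow> (real \<Rightarrow> 'a \<Rightarrow> 'a) \<Rightarrow> nat \<Rightarrow> bool" where
  "globally_accurate u T \<Phi> p \<longleftrightarrow>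
     (\<exists>C. \<forall>\<^sub>F h in at_right 0. \<forall>n. real n * h \<le> T \<longrightarrow>
        norm ((\<Phi> h ^^ n) (u 0) - u (real n * h)) \<le> C * h ^ p)"

end

theory Submission
  imports Defs
begin

text \<open>
  Changing the intermediate stage in the second residual only moves the terms carrying a factor
  \<open>h\<^sup>2\<close>; hence the residual of the first stage enters the error of one step with weight \<open>h\<^sup>2\<close>.
  Stability of the inexact map propagates the errors of the single steps with a bounded amplification
  \<open>(1 + L h)\<^sup>n \<le> exp (L T)\<close>, and summing at most \<open>T / h\<close> of them loses one power of \<open>h\<close>.  Stability
  is only available on the solution neighborhood: the exact orbit stays there because it is accurate,
  the inexact one by a bootstrap, as its distance to the exact orbit tends to \<open>0\<close> with \<open>h\<close>.
\<close>

section \<open>Perturbation of a single step\<close>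

lemma res_one_diff_stage:
  assumes "LF-lipschitz_on D (full_deriv F G F)" "LG-lipschitz_on D (full_deriv F G G)"
    and "X \<in> D" "Y \<in> D"
  shows "norm (res_one F G h U W X - res_one F G h U W Y) \<le> h\<^sup>2 * (LF + LG) * norm (X - Y)"
proof -
  let ?f = "full_deriv F G F X - full_deriv F G F Y"
  let ?g = "full_deriv F G G X - full_deriv F G G Y"
  have f: "norm ?f \<le> LF * norm (X - Y)" and g: "norm ?g \<le> LG * norm (X - Y)"
    using assms by (auto simp: dist_norm dest: lipschitz_onD)
  \<comment> \<open>The stage occurs only in the two terms of weight
    \<open>2 * h\<^sup>2 / 6\<close>; everything of order h cancels. The factor 1/3 is then given
    away.\<close>
  have "res_one F G h U W X - res_one F G h U W Y = (h\<^sup>2 / 3) *\<^sub>R (?g - ?f)"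
    by (simp add: res_one_def algebra_simps)
  then have "norm (res_one F G h U W X - res_one F G h U W Y) = h\<^sup>2 / 3 * norm (?g - ?f)"
    by simp
  also have "\<dots> \<le> h\<^sup>2 * (norm ?g + norm ?f)"
    by (intro mult_mono norm_triangle_ineq4) auto
  also have "\<dots> \<le> h\<^sup>2 * ((LF + LG) * norm (X - Y))"
    using f g by (intro mult_left_mono) (auto simp: algebra_simps)
  finally show ?thesis
    by (simp add: mult.assoc)
qed

lemma one_step_perturbation:
  assumes "bounded_inverse_stage_jacobians F G N D"
    and "\<exists>L. L-lipschitz_on D (full_deriv F G F)" "\<exists>L. L-lipschitz_on D (full_deriv F G G)"
  shows "\<exists>C\<ge>0. \<forall>\<^sub>F h in at_right 0. \<forall>U\<in>N. \<forall>Us\<in>D. \<forall>U1\<in>D. \<forall>Vs\<in>D. \<forall>V1\<in>D.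
      res_star F G h U Us = 0 \<longrightarrow> res_one F G h U U1 Us = 0 \<longrightarrow>
      norm (V1 - U1) \<le>
        C * (h\<^sup>2 * norm (res_star F G h U Vs) + norm (res_one F G h U V1 Vs))"
proof -
  obtain LF LG where LF: "LF-lipschitz_on D (full_deriv F G F)"
    and LG: "LG-lipschitz_on D (full_deriv F G G)"
    using assms by blast
  define L where "L = LF + LG"
  have "0 \<le> L"
    using LF LG by (simp add: L_def lipschitz_on_nonneg)
  obtain C0 where C0: "\<forall>\<^sub>F h in at_right 0. \<forall>U\<in>N. \<forall>V\<in>D. \<forall>W\<in>D.
      norm (V - W) \<le> C0 * norm (res_star F G h U V - res_star F G h U W) \<and>
      (\<forall>X\<in>D. norm (V - W) \<le> C0 * norm (res_one F G h U V X - res_one F G h U W X))"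
    using assms(1) unfolding bounded_inverse_stage_jacobians_def by blast
  \<comment> \<open>The constant \<open>C0\<close> carries no sign; the absolute value makes it
    usable as a monotone factor.\<close>
  define B where "B = \<bar>C0\<bar>"
  have "0 \<le> B"
    by (simp add: B_def)
  have C0_le: "C0 * norm x \<le> B * norm x" for x :: 'a
    by (simp add: B_def mult_right_mono)
  show ?thesis
  proof (intro exI[of _ "B * (1 + L * B)"] conjI)
    show "0 \<le> B * (1 + L * B)"
      using \<open>0 \<le> L\<close> \<open>0 \<le> B\<close> by simp
    show "\<forall>\<^sub>F h in at_right 0. \<forall>U\<in>N. \<forall>Us\<in>D. \<forall>U1\<in>D. \<forall>Vs\<in>D. \<forall>V1\<in>D.
      res_star F G h U Us = 0 \<longrightarrow> res_one F G h U U1 Us = 0 \<longrightarrow>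
      norm (V1 - U1) \<le>
        B * (1 + L * B) * (h\<^sup>2 * norm (res_star F G h U Vs) + norm (res_one F G h U V1 Vs))"
      using C0
    proof (eventually_elim, intro ballI impI)
      fix h :: real and U Us U1 Vs V1
      assume inv: "\<forall>U\<in>N. \<forall>V\<in>D. \<forall>W\<in>D.
          norm (V - W) \<le> C0 * norm (res_star F G h U V - res_star F G h U W) \<and>
          (\<forall>X\<in>D. norm (V - W) \<le> C0 * norm (res_one F G h U V X - res_one F G h U W X))"
        and mem: "U \<in> N" "Us \<in> D" "U1 \<in> D" "Vs \<in> D" "V1 \<in> D"
        and roots: "res_star F G h U Us = 0" "res_one F G h U U1 Us = 0"
      let ?rs = "norm (res_star F G h U Vs)" and ?r1 = "norm (res_one F G h U V1 Vs)"
      have "norm (Vs - Us) \<le> C0 * norm (res_star F G h U Vs - res_star F G h U Us)"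
        using inv mem by blast
      also have "\<dots> \<le> B * ?rs"
        using C0_le roots by simp
      finally have stage: "norm (Us - Vs) \<le> B * ?rs"
        by (simp add: norm_minus_commute)
      have "norm (V1 - U1) \<le> C0 * norm (res_one F G h U V1 Us - res_one F G h U U1 Us)"
        using inv mem by blast
      also have "\<dots> \<le> B * norm (res_one F G h U V1 Us)"
        using C0_le roots by simp
      also have "norm (res_one F G h U V1 Us) \<le> ?r1 + h\<^sup>2 * L * (B * ?rs)"
      proof -
        have "norm (res_one F G h U V1 Us)
            \<le> ?r1 + norm (res_one F G h U V1 Us - res_one F G h U V1 Vs)"
          by (rule norm_triangle_sub)
        also have "norm (res_one F G h U V1 Us - res_one F G h U V1 Vs)
            \<le> h\<^sup>2 * L * norm (Us - Vs)"
          unfolding L_def using LF LG mem by (intro res_one_diff_stage)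
        also have "\<dots> \<le> h\<^sup>2 * L * (B * ?rs)"
          using stage \<open>0 \<le> L\<close> by (intro mult_left_mono) auto
        finally show ?thesis
          by simp
      qed
      \<comment> \<open>The coefficients 1 of \<open>?r1\<close> and \<open>L * B\<close> of
        \<open>h\<^sup>2 * ?rs\<close> are both enlarged to \<open>1 + L * B\<close>; with the outer
        factor \<open>B\<close> this is the witness.\<close>
      also have "\<dots> \<le> (1 + L * B) * (h\<^sup>2 * ?rs + ?r1)"
        using \<open>0 \<le> L\<close> \<open>0 \<le> B\<close> by (simp add: algebra_simps)
      finally show "norm (V1 - U1) \<le> B * (1 + L * B) * (h\<^sup>2 * ?rs + ?r1)"
        using \<open>0 \<le> B\<close> by (simp add: mult_left_mono mult.assoc)
    qed
  qed
qed

section \<open>Accumulation of local errors and confinement to the neighborhood\<close>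

text \<open>A discrete Gronwall argument with \<open>P\<close> the inexact and \<open>Q\<close> the
  exact map. Only \<open>P\<close> has to be stable, because the local error is inserted at the
  point of the \<open>Q\<close>-orbit. The number \<open>d\<close> is the local error per unit time,
  so that n steps collect n * h * d \<le> T * d. Membership is asked only for k < n, which leaves
  the last point free for the bootstrap.\<close>

lemma orbit_perturbation:
  fixes P Q :: "'a::real_normed_vector \<Rightarrow> 'a"
  assumes nonneg: "0 \<le> h" "0 \<le> L" "0 \<le> d"
    and stab: "\<And>V W. V \<in> N \<Longrightarrow> W \<in> N \<Longrightarrow> norm (P V - P W) \<le> (1 + L * h) * norm (V - W)"
    and loc: "\<And>V. V \<in> N \<Longrightarrow> norm (P V - Q V) \<le> h * d"
    and orbits: "\<And>k. k < n \<Longrightarrow> (P ^^ k) x \<in> N \<and> (Q ^^ k) x \<in> N"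
    and time: "real n * h \<le> T"
  shows "norm ((P ^^ n) x - (Q ^^ n) x) \<le> T * exp (L * T) * d"
proof -
  \<comment> \<open>This is cruder than the geometric sum, but involves no division by
    \<open>L\<close>, which may be 0.\<close>
  have "norm ((P ^^ k) x - (Q ^^ k) x) \<le> real k * h * d * (1 + L * h) ^ k" if "k \<le> n" for k
    using that
  proof (induction k)
    case (Suc k)
    let ?p = "(P ^^ k) x" and ?q = "(Q ^^ k) x"
    have mem: "?p \<in> N" "?q \<in> N"
      using orbits Suc.prems by auto
    have "norm (P ?p - Q ?q) \<le> norm (P ?p - P ?q) + norm (P ?q - Q ?q)"
      using norm_triangle_ineq[of "P ?p - P ?q" "P ?q - Q ?q"] by simp
    also have "\<dots> \<le> (1 + L * h) * norm (?p - ?q) + h * d"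
      by (intro add_mono stab loc mem)
    also have "\<dots> \<le> (1 + L * h) * (real k * h * d * (1 + L * h) ^ k) + h * d * (1 + L * h) ^ Suc k"
    proof (intro add_mono mult_left_mono)
      show "h * d \<le> h * d * (1 + L * h) ^ Suc k"
        using nonneg mult_left_mono[OF one_le_power[of "1 + L * h" "Suc k"], of "h * d"] by simp
    qed (use Suc nonneg in auto)
    also have "\<dots> = real (Suc k) * h * d * (1 + L * h) ^ Suc k"
      by (simp add: algebra_simps)
    finally show ?case
      by simp
  qed simp
  then have growth: "norm ((P ^^ n) x - (Q ^^ n) x) \<le> real n * h * d * (1 + L * h) ^ n"
    by simp
  have "0 \<le> T"
    using order_trans[OF mult_nonneg_nonneg time] nonneg by simp
  have "real n * h * d * (1 + L * h) ^ n \<le> T * d * exp (L * T)"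
  proof (intro mult_mono)
    have "(1 + L * h) ^ n \<le> exp (L * h) ^ n"
      using nonneg by (intro power_mono exp_ge_add_one_self) auto
    also have "\<dots> = exp (L * (real n * h))"
      by (simp add: exp_of_nat_mult[symmetric] algebra_simps)
    also have "\<dots> \<le> exp (L * T)"
      using time nonneg by (simp add: mult_left_mono)
    finally show "(1 + L * h) ^ n \<le> exp (L * T)" .
  qed (use time nonneg \<open>0 \<le> T\<close> in auto)
  with growth show ?thesis
    by (simp add: mult_ac)
qed

text \<open>Bootstrap by strong induction: if all earlier points lie in \<open>N\<close>, the
  accumulated error bound already holds at step n and puts the new point into a ball contained in
  \<open>N\<close>.\<close>

lemma perturbed_orbit_mem:
  fixes P Q :: "'a::real_normed_vector \<Rightarrow> 'a"
  assumes nonneg: "0 \<le> h" "0 \<le> L" "0 \<le> d"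
    and stab: "\<And>V W. V \<in> N \<Longrightarrow> W \<in> N \<Longrightarrow> norm (P V - P W) \<le> (1 + L * h) * norm (V - W)"
    and loc: "\<And>V. V \<in> N \<Longrightarrow> norm (P V - Q V) \<le> h * d"
    and tube: "\<And>k. real k * h \<le> T \<Longrightarrow> cball ((Q ^^ k) x) (T * exp (L * T) * d) \<subseteq> N"
    and time: "real n * h \<le> T"
  shows "(P ^^ n) x \<in> N"
  using time
proof (induction n rule: less_induct)
  case (less n)
  have "0 \<le> T"
    using order_trans[OF mult_nonneg_nonneg less.prems] nonneg by simp
  have "(P ^^ k) x \<in> N \<and> (Q ^^ k) x \<in> N" if "k < n" for k
  proof -
    have "real k * h \<le> real n * h"
      using that nonneg by (intro mult_right_mono) auto
    then have "real k * h \<le> T"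
      using less.prems by linarith
    then show ?thesis
      using less.IH[OF that] tube[of k] \<open>0 \<le> T\<close> nonneg by auto
  qed
  then have "norm ((P ^^ n) x - (Q ^^ n) x) \<le> T * exp (L * T) * d"
    using nonneg stab loc less.prems by (intro orbit_perturbation[where N = N and h = h]) auto
  then have "(P ^^ n) x \<in> cball ((Q ^^ n) x) (T * exp (L * T) * d)"
    by (simp add: dist_norm norm_minus_commute)
  then show ?case
    using tube[OF less.prems] by blast
qed

text \<open>The margin \<open>\<delta>\<close> is split: one half absorbs the discretization error,
  which tends to 0 since p > 0, and the other half remains available for the inexact solves.\<close>

lemma globally_accurate_tube:
  assumes "globally_accurate u T \<Phi> p" "0 < p"
    and nbhd: "\<And>t. t \<in> {0..T} \<Longrightarrow> ball (u t) \<delta> \<subseteq> N" and "0 < \<delta>"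
  shows "\<forall>\<^sub>F h in at_right 0. \<forall>n. real n * h \<le> T \<longrightarrow> ball ((\<Phi> h ^^ n) (u 0)) (\<delta> / 2) \<subseteq> N"
proof -
  obtain C where C: "\<forall>\<^sub>F h in at_right 0. \<forall>n. real n * h \<le> T \<longrightarrow>
      norm ((\<Phi> h ^^ n) (u 0) - u (real n * h)) \<le> C * h ^ p"
    using assms(1) unfolding globally_accurate_def by blast
  have "((\<lambda>h. C * h ^ p) \<longlongrightarrow> C * 0 ^ p) (at_right (0::real))"
    by (intro tendsto_intros)
  then have "\<forall>\<^sub>F h in at_right 0. C * h ^ p < \<delta> / 2"
    using \<open>0 < p\<close> \<open>0 < \<delta>\<close> by (intro order_tendstoD) (auto simp: zero_power)
  with C eventually_at_right_less[of "0::real"] show ?thesis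
  proof (eventually_elim, intro allI impI subsetI)
    fix h :: real and n y
    assume acc: "\<forall>n. real n * h \<le> T \<longrightarrow>
        norm ((\<Phi> h ^^ n) (u 0) - u (real n * h)) \<le> C * h ^ p"
      and "0 < h" and small: "C * h ^ p < \<delta> / 2" and "real n * h \<le> T"
      and y: "y \<in> ball ((\<Phi> h ^^ n) (u 0)) (\<delta> / 2)"
    let ?z = "(\<Phi> h ^^ n) (u 0)"
    have "dist (u (real n * h)) ?z < \<delta> / 2"
      using acc small \<open>real n * h \<le> T\<close> by (fastforce simp: dist_norm norm_minus_commute)
    moreover have "dist ?z y < \<delta> / 2"
      using y by simp
    ultimately have "dist (u (real n * h)) y < \<delta>"
      using dist_triangle[of "u (real n * h)" y ?z] by linarith
    then show "y \<in> N"
      using nbhd[of "real n * h"] \<open>0 < h\<close> \<open>real n * h \<le> T\<close> by auto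
  qed
qed

section \<open>Global error for given residual orders\<close>

text \<open>Real exponents with \<open>powr\<close> cover arbitrary residual orders. For ps > -1 and
  p1 > 1 the accumulated error tends to 0, and the bootstrap keeps the inexact orbit in
  \<open>N\<close>; for other orders this confinement is a premise of the estimate.\<close>

theorem proposition5p3:
  fixes F G :: "'a::real_normed_vector \<Rightarrow> 'a"
    and u :: "real \<Rightarrow> 'a" and T :: real
    and N D :: "'a set"
    and \<Sigma> \<Phi> :: "real \<Rightarrow> 'a \<Rightarrow> 'a"
    and \<Sigma>' \<Phi>' :: "real \<Rightarrow> 'a \<Rightarrow> 'a"
  assumes T_pos: "0 < T"
    and differentiable: "\<And>x. x \<in> N \<union> D \<Longrightarrow> F differentiable (at x) \<and> G differentiable (at x)"
    and solution: "\<And>t. t \<in> {0..T} \<Longrightarrow>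
          (u has_vector_derivative (F (u t) + G (u t))) (at t within {0..T})"
    and solution_nbhd: "\<exists>\<delta>>0. \<forall>t\<in>{0..T}. ball (u t) \<delta> \<subseteq> N"
    and exact_stages: "\<forall>\<^sub>F h in at_right 0. \<forall>U\<in>N.
          \<Sigma> h U \<in> D \<and> \<Phi> h U \<in> D \<and>
          res_star F G h U (\<Sigma> h U) = 0 \<and> res_one F G h U (\<Phi> h U) (\<Sigma> h U) = 0"
    and inexact_stages: "\<forall>\<^sub>F h in at_right 0. \<forall>U\<in>N. \<Sigma>' h U \<in> D \<and> \<Phi>' h U \<in> D"
    and exact_accuracy: "globally_accurate u T \<Phi> 4"
    and jacobians: "bounded_inverse_stage_jacobians F G N D"
    and lipschitz_F: "\<exists>L. L-lipschitz_on D (full_deriv F G F)"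
    and lipschitz_G: "\<exists>L. L-lipschitz_on D (full_deriv F G G)"
    and stable: "stable_on N \<Phi>'"
  shows
    "(\<exists>C\<ge>0. \<forall>\<^sub>F h in at_right 0. \<forall>U\<in>N. \<forall>Us\<in>D. \<forall>U1\<in>D. \<forall>Vs\<in>D. \<forall>V1\<in>D.
        res_star F G h U Us = 0 \<longrightarrow> res_one F G h U U1 Us = 0 \<longrightarrow>
        norm (V1 - U1) \<le>
          C * (h\<^sup>2 * norm (res_star F G h U Vs) + norm (res_one F G h U V1 Vs)))
     \<and>
     ((\<exists>K. \<forall>\<^sub>F h in at_right 0. \<forall>U\<in>N.
         norm (res_star F G h U (\<Sigma>' h U)) \<le> K * h ^ 3 \<and>
         norm (res_one F G h U (\<Phi>' h U) (\<Sigma>' h U)) \<le> K * h ^ 5)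
       \<longrightarrow> globally_accurate u T \<Phi>' 4)
     \<and>
     (\<exists>C\<ge>0. \<forall>ps p1 Ks K1 :: real.
        (\<forall>\<^sub>F h in at_right 0. \<forall>U\<in>N.
           norm (res_star F G h U (\<Sigma>' h U)) \<le> Ks * h powr ps \<and>
           norm (res_one F G h U (\<Phi>' h U) (\<Sigma>' h U)) \<le> K1 * h powr p1) \<longrightarrow>
        (\<forall>\<^sub>F h in at_right 0. \<forall>n. real n * h \<le> T \<longrightarrow>
           (ps > -1 \<and> p1 > 1) \<or> (\<forall>k<n. (\<Phi>' h ^^ k) (u 0) \<in> N) \<longrightarrow>
           norm ((\<Phi>' h ^^ n) (u 0) - (\<Phi> h ^^ n) (u 0)) \<le>
             C * (Ks * h powr (ps + 1) + K1 * h powr (p1 - 1))))"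
proof -
  let ?local = "\<lambda>C. \<forall>\<^sub>F h in at_right 0. \<forall>U\<in>N. \<forall>Us\<in>D. \<forall>U1\<in>D. \<forall>Vs\<in>D. \<forall>V1\<in>D.
        res_star F G h U Us = 0 \<longrightarrow> res_one F G h U U1 Us = 0 \<longrightarrow>
        norm (V1 - U1) \<le>
          C * (h\<^sup>2 * norm (res_star F G h U Vs) + norm (res_one F G h U V1 Vs))"
  let ?residuals = "\<lambda>ps p1 Ks K1. \<forall>\<^sub>F h in at_right 0. \<forall>U\<in>N.
        norm (res_star F G h U (\<Sigma>' h U)) \<le> Ks * h powr ps \<and>
        norm (res_one F G h U (\<Phi>' h U) (\<Sigma>' h U)) \<le> K1 * h powr p1"
  let ?global = "\<lambda>C ps p1 Ks K1. \<forall>\<^sub>F h in at_right 0. \<forall>n. real n * h \<le> T \<longrightarrow>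
        (ps > -1 \<and> p1 > 1) \<or> (\<forall>k<n. (\<Phi>' h ^^ k) (u 0) \<in> N) \<longrightarrow>
        norm ((\<Phi>' h ^^ n) (u 0) - (\<Phi> h ^^ n) (u 0)) \<le>
          C * (Ks * h powr (ps + 1) + K1 * h powr (p1 - 1))"
  obtain C1 where "0 \<le> C1" and local: "?local C1"
    using one_step_perturbation[OF jacobians lipschitz_F lipschitz_G] by blast
  obtain \<delta> where "0 < \<delta>" and \<delta>: "\<And>t. t \<in> {0..T} \<Longrightarrow> ball (u t) \<delta> \<subseteq> N"
    using solution_nbhd by blast
  have "u 0 \<in> N"
    using \<delta>[of 0] T_pos \<open>0 < \<delta>\<close> by auto
  have tube: "\<forall>\<^sub>F h in at_right 0. \<forall>n. real n * h \<le> T \<longrightarrow>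
      ball ((\<Phi> h ^^ n) (u 0)) (\<delta> / 2) \<subseteq> N"
    using exact_accuracy \<delta> \<open>0 < \<delta>\<close> by (intro globally_accurate_tube[where p = 4]) auto
  obtain L0 where L0: "\<forall>\<^sub>F h in at_right 0. \<forall>V\<in>N. \<forall>W\<in>N.
        norm (\<Phi>' h V - \<Phi>' h W) \<le> (1 + L0 * h) * norm (V - W)"
    using stable unfolding stable_on_def by blast
  define L where "L = \<bar>L0\<bar>"
  \<comment> \<open>Gronwall factor times one-step constant, fixed before the orders and the
    residual constants are given.\<close>
  define C where "C = T * exp (L * T) * C1"
  have "0 \<le> L" "0 \<le> C"
    using T_pos \<open>0 \<le> C1\<close> by (simp_all add: L_def C_def)
  have global: "?global C ps p1 Ks K1" if res: "?residuals ps p1 Ks K1" for ps p1 Ks K1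
  proof -
    \<comment> \<open>Up to the factor \<open>C1\<close>, this is the local error divided by h; see
      \<open>hE\<close> below.\<close>
    define E where "E h = Ks * h powr (ps + 1) + K1 * h powr (p1 - 1)" for h
    have small: "\<forall>\<^sub>F h in at_right 0. ps > -1 \<and> p1 > 1 \<longrightarrow> C * E h < \<delta> / 2"
    proof (cases "ps > -1 \<and> p1 > 1")
      case True
      \<comment> \<open>Both exponents are positive, so the powers are continuous from the right at
        0, and the limit is 0 because \<open>0 powr a = 0\<close>.\<close>
      have "((\<lambda>h. C * E h) \<longlongrightarrow> C * (Ks * 0 powr (ps + 1) + K1 * 0 powr (p1 - 1))) (at_right 0)"
        unfolding E_def using True
        by (intro tendsto_mult_left tendsto_add tendsto_powr' tendsto_const tendsto_ident_at)
          (auto simp: eventually_at_right_less eventually_at_filter)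
      then have "\<forall>\<^sub>F h in at_right 0. C * E h < \<delta> / 2"
        using \<open>0 < \<delta>\<close> by (intro order_tendstoD) auto
      then show ?thesis
        by (rule eventually_mono) simp
    next
      case False
      then show ?thesis
        by (intro always_eventually) auto
    qed
    show ?thesis
      using local res exact_stages inexact_stages tube L0 small eventually_at_right_less[of "0::real"]
    proof (eventually_elim, intro allI impI)
      fix h :: real and n
      assume local: "\<forall>U\<in>N. \<forall>Us\<in>D. \<forall>U1\<in>D. \<forall>Vs\<in>D. \<forall>V1\<in>D.
          res_star F G h U Us = 0 \<longrightarrow> res_one F G h U U1 Us = 0 \<longrightarrow>
          norm (V1 - U1) \<le>
            C1 * (h\<^sup>2 * norm (res_star F G h U Vs) + norm (res_one F G h U V1 Vs))"
        and res: "\<forall>U\<in>N. norm (res_star F G h U (\<Sigma>' h U)) \<le> Ks * h powr ps \<and>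
          norm (res_one F G h U (\<Phi>' h U) (\<Sigma>' h U)) \<le> K1 * h powr p1"
        and exact: "\<forall>U\<in>N. \<Sigma> h U \<in> D \<and> \<Phi> h U \<in> D \<and>
          res_star F G h U (\<Sigma> h U) = 0 \<and> res_one F G h U (\<Phi> h U) (\<Sigma> h U) = 0"
        and inexact: "\<forall>U\<in>N. \<Sigma>' h U \<in> D \<and> \<Phi>' h U \<in> D"
        and tube: "\<forall>n. real n * h \<le> T \<longrightarrow> ball ((\<Phi> h ^^ n) (u 0)) (\<delta> / 2) \<subseteq> N"
        and stab0: "\<forall>V\<in>N. \<forall>W\<in>N. norm (\<Phi>' h V - \<Phi>' h W) \<le> (1 + L0 * h) * norm (V - W)"
        and small: "ps > -1 \<and> p1 > 1 \<longrightarrow> C * E h < \<delta> / 2"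
        and "0 < h" and time: "real n * h \<le> T"
        and orbit: "(ps > -1 \<and> p1 > 1) \<or> (\<forall>k<n. (\<Phi>' h ^^ k) (u 0) \<in> N)"
      \<comment> \<open>The signs of \<open>Ks\<close> and \<open>K1\<close> come from the residual
        bounds at the point \<open>u 0\<close> of \<open>N\<close>; they make the local error bound
        nonnegative.\<close>
      have "0 \<le> Ks * h powr ps" "0 \<le> K1 * h powr p1"
        using res \<open>u 0 \<in> N\<close> by (meson norm_ge_zero order_trans)+
      then have "0 \<le> Ks" "0 \<le> K1"
        using \<open>0 < h\<close> by (simp_all add: zero_le_mult_iff)
      then have "0 \<le> C1 * E h"
        using \<open>0 \<le> C1\<close> by (simp add: E_def)
      \<comment> \<open>The weight h^2 raises the order of the first residual by two, the second has
        weight 1, and dividing by h lowers both by one: hence ps + 1 and p1 - 1.\<close>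
      have hE: "h * E h = h\<^sup>2 * (Ks * h powr ps) + K1 * h powr p1"
        using \<open>0 < h\<close> by (simp add: E_def powr_add powr_diff power2_eq_square algebra_simps)
      have loc: "norm (\<Phi>' h U - \<Phi> h U) \<le> h * (C1 * E h)" if "U \<in> N" for U
      proof -
        have "norm (\<Phi>' h U - \<Phi> h U) \<le> C1 * (h\<^sup>2 * norm (res_star F G h U (\<Sigma>' h U)) +
            norm (res_one F G h U (\<Phi>' h U) (\<Sigma>' h U)))"
          using local exact inexact that by blast
        also have "\<dots> \<le> C1 * (h\<^sup>2 * (Ks * h powr ps) + K1 * h powr p1)"
          using res that \<open>0 \<le> C1\<close> by (intro mult_left_mono add_mono) auto
        finally show ?thesis
          unfolding hE[symmetric] by (simp add: mult.left_commute)
      qed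
      have stab: "norm (\<Phi>' h V - \<Phi>' h W) \<le> (1 + L * h) * norm (V - W)"
        if "V \<in> N" "W \<in> N" for V W
      proof -
        have "(1 + L0 * h) * norm (V - W) \<le> (1 + L * h) * norm (V - W)"
          using \<open>0 < h\<close> by (intro mult_right_mono) (auto simp: L_def)
        then show ?thesis
          using stab0 that by force
      qed
      have before: "real k * h \<le> T" if "k < n" for k
        using order_trans[OF mult_right_mono time] that \<open>0 < h\<close> by simp
      have "(\<Phi> h ^^ k) (u 0) \<in> N" if "k < n" for k
        using tube before[OF that] \<open>0 < \<delta>\<close> by (meson centre_in_ball half_gt_zero subsetD)
      moreover have "(\<Phi>' h ^^ k) (u 0) \<in> N" if "k < n" for k
        using orbit
      proof
        assume orders: "ps > -1 \<and> p1 > 1"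
        have "cball ((\<Phi> h ^^ j) (u 0)) (T * exp (L * T) * (C1 * E h)) \<subseteq> N"
          if "real j * h \<le> T" for j
        proof -
          \<comment> \<open>The strict inequality fits the closed ball of the bootstrap into the
            open ball of the tube.\<close>
          have "T * exp (L * T) * (C1 * E h) < \<delta> / 2"
            using small orders by (simp add: C_def mult_ac)
          then have "cball ((\<Phi> h ^^ j) (u 0)) (T * exp (L * T) * (C1 * E h))
              \<subseteq> ball ((\<Phi> h ^^ j) (u 0)) (\<delta> / 2)"
            by auto
          then show ?thesis
            using tube that by blast
        qed
        then show ?thesis
          using \<open>0 < h\<close> \<open>0 \<le> L\<close> \<open>0 \<le> C1 * E h\<close> stab loc before[OF that]
          by (intro perturbed_orbit_mem[where Q = "\<Phi> h" and N = N and h = h and L = L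
                and d = "C1 * E h"]) auto
      qed (use that in blast)
      ultimately have "norm ((\<Phi>' h ^^ n) (u 0) - (\<Phi> h ^^ n) (u 0)) \<le> T * exp (L * T) * (C1 * E h)"
        using \<open>0 < h\<close> \<open>0 \<le> L\<close> \<open>0 \<le> C1 * E h\<close> stab loc time
        by (intro orbit_perturbation[where N = N and h = h and L = L]) auto
      then show "norm ((\<Phi>' h ^^ n) (u 0) - (\<Phi> h ^^ n) (u 0))
          \<le> C * (Ks * h powr (ps + 1) + K1 * h powr (p1 - 1))"
        by (simp add: C_def E_def mult.assoc)
    qed
  qed
  have "globally_accurate u T \<Phi>' 4"
    if K: "\<forall>\<^sub>F h in at_right 0. \<forall>U\<in>N.
         norm (res_star F G h U (\<Sigma>' h U)) \<le> K * h ^ 3 \<and>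
         norm (res_one F G h U (\<Phi>' h U) (\<Sigma>' h U)) \<le> K * h ^ 5" for K
  proof -
    obtain A where A: "\<forall>\<^sub>F h in at_right 0. \<forall>n. real n * h \<le> T \<longrightarrow>
        norm ((\<Phi> h ^^ n) (u 0) - u (real n * h)) \<le> A * h ^ 4"
      using exact_accuracy unfolding globally_accurate_def by blast
    \<comment> \<open>Orders 3 and 5 balance, as 3 + 1 = 5 - 1 = 4; each residual then contributes C
      * K * h^4, which explains the constant \<open>2 * C * K + A\<close>.\<close>
    have "?residuals 3 5 K K"
      using K eventually_at_right_less[of "0::real"] by eventually_elim simp
    from global[OF this] A eventually_at_right_less[of "0::real"]
    have "\<forall>\<^sub>F h in at_right 0. \<forall>n. real n * h \<le> T \<longrightarrow>
        norm ((\<Phi>' h ^^ n) (u 0) - u (real n * h)) \<le> (2 * C * K + A) * h ^ 4"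
    proof (eventually_elim, intro allI impI)
      fix h :: real and n
      assume pert: "\<forall>n. real n * h \<le> T \<longrightarrow>
          ((3::real) > -1 \<and> (5::real) > 1) \<or> (\<forall>k<n. (\<Phi>' h ^^ k) (u 0) \<in> N) \<longrightarrow>
          norm ((\<Phi>' h ^^ n) (u 0) - (\<Phi> h ^^ n) (u 0)) \<le>
            C * (K * h powr (3 + 1) + K * h powr (5 - 1))"
        and acc: "\<forall>n. real n * h \<le> T \<longrightarrow>
          norm ((\<Phi> h ^^ n) (u 0) - u (real n * h)) \<le> A * h ^ 4"
        and "0 < h" and time: "real n * h \<le> T"
      have "norm ((\<Phi>' h ^^ n) (u 0) - (\<Phi> h ^^ n) (u 0)) \<le> C * (K * h ^ 4 + K * h ^ 4)"
        using pert time \<open>0 < h\<close> by simp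
      moreover have "norm ((\<Phi> h ^^ n) (u 0) - u (real n * h)) \<le> A * h ^ 4"
        using acc time by blast
      ultimately show "norm ((\<Phi>' h ^^ n) (u 0) - u (real n * h)) \<le> (2 * C * K + A) * h ^ 4"
        using norm_triangle_ineq[of "(\<Phi>' h ^^ n) (u 0) - (\<Phi> h ^^ n) (u 0)"
            "(\<Phi> h ^^ n) (u 0) - u (real n * h)"]
        by (simp add: algebra_simps)
    qed
    then show ?thesis
      unfolding globally_accurate_def by blast
  qed
  with global local \<open>0 \<le> C1\<close> \<open>0 \<le> C\<close> show ?thesis
    by blast
qed

end
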